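(* Let $m\ge 2$, let $\Gamma$ be a compact Lie group, let $\sigma:\Gamma\to\mathbf{Z}_m$ be a group epimorphism with kernel $K=\ker\sigma$, and let $\rho,\eta:\Gamma\to\mathbf{GL}(V)$ be two representations of $\Gamma$ on a finite-dimensional complex vector space $V$. Then the following direct sum decomposition of $\mathcal{P}(\Gamma)$-modules holds: $$\vec{\mathcal{P}}(K)=\bigoplus_{j=0}^{m-1}\vec{\mathcal{P}}_{\sigma^{j}}(\Gamma).$$
   Context: $\mathbf{Z}_m\subset\mathbf{C}^{*}$ is the cyclic group of $m$-th roots of unity, and $\sigma^j(\gamma)=\sigma(\gamma)^j$. Polynomial functions and mappings on $V$ have complex coefficients. $\mathcal{P}(\Gamma)$ is the ring of $\Gamma$-invariant polynomial functions, i.e. polynomial $f:V\to\mathbf{C}$ with $f(\rho(\gamma)x)=f(x)$ for all $\gamma\in\Gamma$, $x\in V$. $\vec{\mathcal{P}}(K)$ is the set of $K$-equivariant polynomial mappings, i.e. polynomial $g:V\to V$ with $g(\rho(\kappa)x)=\eta(\kappa)g(x)$ for all $\kappa\in K$, $x\in V$. For $0\le j\le m-1$, $\vec{\mathcal{P}}_{\sigma^j}(\Gamma)$ is the set of $\sigma^j$-relative equivariant polynomial mappings, i.e. polynomial $g:V\to V$ with $g(\rho(\gamma)x)=\sigma^j(\gamma)\,\eta(\gamma)g(x)$ for all $\gamma\in\Gamma$, $x\in V$; for $j=0$ this is the module $\vec{\mathcal{P}}(\Gamma)$ of $\Gamma$-equivariant polynomial mappings. All these sets of mappings are modules over $\mathcal{P}(\Gamma)$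 by pointwise multiplication. *)

theory Defs
  imports "HOL-Analysis.Analysis" "HOL-Algebra.Module" "HOL-Algebra.Coset"
begin

section \<open>Smooth maps between open sets of Euclidean spaces\<close>

text \<open>
  The space \<open>\<real>\<^sup>n\<close> is the library's \<^const>\<open>Euclidean_space\<close> \<open>n\<close>, whose points are the functions
  \<open>x :: nat \<Rightarrow> real\<close> with \<open>x i = 0\<close> for \<open>i \<ge> n\<close>. Unlike the class of Euclidean spaces it includes
  \<open>n = 0\<close>, so that finite groups are compact Lie groups (of dimension \<open>0\<close>).
\<close>

definition has_partial :: "nat \<Rightarrow> ((nat \<Rightarrow> real) \<Rightarrow> real) \<Rightarrow> (nat \<Rightarrow> real) \<Rightarrow> bool" where
  "has_partial i f x \<longleftrightarrow> (\<lambda>t. f (x(i := t))) differentiable (at (x i))"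

definition partial_deriv :: "nat \<Rightarrow> ((nat \<Rightarrow> real) \<Rightarrow> real) \<Rightarrow> (nat \<Rightarrow> real) \<Rightarrow> real" where
  "partial_deriv i f x = deriv (\<lambda>t. f (x(i := t))) (x i)"

text \<open>\<open>Ck_on n k D f\<close>: \<open>f\<close> is of class \<open>C\<^sup>k\<close> on the open set \<open>D\<close> of \<open>\<real>\<^sup>n\<close>.\<close>

primrec Ck_on :: "nat \<Rightarrow> nat \<Rightarrow> (nat \<Rightarrow> real) set \<Rightarrow> ((nat \<Rightarrow> real) \<Rightarrow> real) \<Rightarrow> bool" where
  "Ck_on n 0 D f \<longleftrightarrow> continuous_map (subtopology (Euclidean_space n) D) euclideanreal f"
| "Ck_on n (Suc k) D f \<longleftrightarrow>
     continuous_map (subtopology (Euclidean_space n) D) euclideanreal f \<and>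
     (\<forall>i<n. (\<forall>x\<in>D. has_partial i f x) \<and> Ck_on n k D (partial_deriv i f))"

definition smooth_map_on ::
  "nat \<Rightarrow> nat \<Rightarrow> (nat \<Rightarrow> real) set \<Rightarrow> ((nat \<Rightarrow> real) \<Rightarrow> (nat \<Rightarrow> real)) \<Rightarrow> bool" where
  "smooth_map_on n p D F \<longleftrightarrow> (\<forall>j<p. \<forall>k. Ck_on n k D (\<lambda>x. F x j))"

text \<open>The two projections of \<open>\<real>\<^sup>n\<^sup>+\<^sup>n = \<real>\<^sup>n \<times> \<real>\<^sup>n\<close>.\<close>

definition proj_left :: "nat \<Rightarrow> (nat \<Rightarrow> real) \<Rightarrow> (nat \<Rightarrow> real)" where
  "proj_left n z = (\<lambda>i. if i < n then z i else 0)"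

definition proj_right :: "nat \<Rightarrow> (nat \<Rightarrow> real) \<Rightarrow> (nat \<Rightarrow> real)" where
  "proj_right n z = (\<lambda>i. if i < n then z (n + i) else 0)"


section \<open>Smooth manifolds and compact Lie groups\<close>

definition chart :: "'g topology \<Rightarrow> nat \<Rightarrow> 'g set \<Rightarrow> ('g \<Rightarrow> nat \<Rightarrow> real) \<Rightarrow> bool" where
  "chart T n U \<phi> \<longleftrightarrow>
     openin T U \<and> openin (Euclidean_space n) (\<phi> ` U) \<and>
     homeomorphic_map (subtopology T U) (subtopology (Euclidean_space n) (\<phi> ` U)) \<phi>"

text \<open>
  An atlas is a set of pairs (domain, coordinate map). It need not be maximal: smoothness of maps
  with respect to an atlas and to the maximal atlas containing it agree.
\<close>

locale smooth_manifold =
  fixes T :: "'g topology" and n :: nat and A :: "('g set \<times> ('g \<Rightarrow> nat \<Rightarrow> real)) set"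
  assumes hausdorff: "Hausdorff_space T"
    and second_countable: "second_countable T"
    and charts: "(U, \<phi>) \<in> A \<Longrightarrow> chart T n U \<phi>"
    and cover: "\<Union> (fst ` A) = topspace T"
    and transition_smooth:
      "\<lbrakk>(U, \<phi>) \<in> A; (V, \<psi>) \<in> A\<rbrakk> \<Longrightarrow>
        smooth_map_on n n (\<phi> ` (U \<inter> V)) (\<lambda>x. \<psi> (inv_into U \<phi> x))"

locale lie_group = group G + smooth_manifold T n A
  for G :: "('g, 'z) monoid_scheme" (structure) and T n A +
  assumes topspace_eq: "topspace T = carrier G"
    and mult_continuous: "continuous_map (prod_topology T T) T (\<lambda>(g, h). g \<otimes> h)"
    and inv_continuous: "continuous_map T T (\<lambda>g. inv g)"
    and mult_smooth:
      "\<lbrakk>(U, \<phi>) \<in> A; (V, \<psi>) \<in> A; (W, \<tau>) \<in> A\<rbrakk> \<Longrightarrow>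
        smooth_map_on (n + n) n
          {z \<in> topspace (Euclidean_space (n + n)).
             proj_left n z \<in> \<phi> ` U \<and> proj_right n z \<in> \<psi> ` V \<and>
             inv_into U \<phi> (proj_left n z) \<otimes> inv_into V \<psi> (proj_right n z) \<in> W}
          (\<lambda>z. \<tau> (inv_into U \<phi> (proj_left n z) \<otimes> inv_into V \<psi> (proj_right n z)))"
    and inv_smooth:
      "\<lbrakk>(U, \<phi>) \<in> A; (W, \<tau>) \<in> A\<rbrakk> \<Longrightarrow>
        smooth_map_on n n
          {x \<in> \<phi> ` U. inv (inv_into U \<phi> x) \<in> W}
          (\<lambda>x. \<tau> (inv (inv_into U \<phi> x)))"

locale compact_lie_group = lie_group +
  assumes compact: "compact_space T"


section \<open>Representations and the group of roots of unity\<close>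

text \<open>
  A complex vector space is given by its scalar multiplication \<open>s :: complex \<Rightarrow> 'v \<Rightarrow> 'v\<close> on the
  type \<open>'v\<close>, as in the library's \<^locale>\<open>finite_dimensional_vector_space\<close>.
\<close>

definition linear_functional :: "(complex \<Rightarrow> 'v::ab_group_add \<Rightarrow> 'v) \<Rightarrow> ('v \<Rightarrow> complex) \<Rightarrow> bool" where
  "linear_functional s l \<longleftrightarrow> Vector_Spaces.linear s (*) l"

definition GL :: "(complex \<Rightarrow> 'v::ab_group_add \<Rightarrow> 'v) \<Rightarrow> ('v \<Rightarrow> 'v) monoid" where
  "GL s = \<lparr>carrier = {f. Vector_Spaces.linear s s f \<and> bij f}, mult = (\<circ>), one = id\<rparr>"

text \<open>
  Continuity of a homomorphism into \<open>GL(V)\<close>, for finite-dimensional \<open>V\<close>, is continuity of all its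
  matrix coefficients.
\<close>

definition lie_representation ::
  "('g, 'z) monoid_scheme \<Rightarrow> 'g topology \<Rightarrow> (complex \<Rightarrow> 'v::ab_group_add \<Rightarrow> 'v) \<Rightarrow>
   ('g \<Rightarrow> 'v \<Rightarrow> 'v) \<Rightarrow> bool" where
  "lie_representation G T s \<rho> \<longleftrightarrow>
     \<rho> \<in> hom G (GL s) \<and>
     (\<forall>l v. linear_functional s l \<longrightarrow> continuous_map T euclidean (\<lambda>\<gamma>. l (\<rho> \<gamma> v)))"

definition roots_of_unity :: "nat \<Rightarrow> complex monoid" where
  "roots_of_unity m = \<lparr>carrier = {z. z ^ m = 1}, mult = (*), one = 1\<rparr>"


section \<open>Polynomial functions and mappings\<close>

text \<open>
  Polynomial functions are the elements of the subalgebra of \<open>V \<Rightarrow> \<complex>\<close> generated by the linear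
  functionals, i.e. the polynomials in the coordinates with respect to any basis.
\<close>

inductive_set poly_functions :: "(complex \<Rightarrow> 'v::ab_group_add \<Rightarrow> 'v) \<Rightarrow> ('v \<Rightarrow> complex) set"
  for s :: "complex \<Rightarrow> 'v::ab_group_add \<Rightarrow> 'v" where
  const: "(\<lambda>_. c) \<in> poly_functions s"
| linear: "linear_functional s l \<Longrightarrow> l \<in> poly_functions s"
| add: "\<lbrakk>f \<in> poly_functions s; g \<in> poly_functions s\<rbrakk> \<Longrightarrow> (\<lambda>x. f x + g x) \<in> poly_functions s"
| mult: "\<lbrakk>f \<in> poly_functions s; g \<in> poly_functions s\<rbrakk> \<Longrightarrow> (\<lambda>x. f x * g x) \<in> poly_functions s"

text \<open>A mapping \<open>V \<Rightarrow> V\<close> is polynomial if all its components are.\<close>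

definition poly_maps :: "(complex \<Rightarrow> 'v::ab_group_add \<Rightarrow> 'v) \<Rightarrow> ('v \<Rightarrow> 'v) set" where
  "poly_maps s = {g. \<forall>l. linear_functional s l \<longrightarrow> (\<lambda>x. l (g x)) \<in> poly_functions s}"

definition invariants ::
  "('g, 'z) monoid_scheme \<Rightarrow> (complex \<Rightarrow> 'v::ab_group_add \<Rightarrow> 'v) \<Rightarrow> ('g \<Rightarrow> 'v \<Rightarrow> 'v) \<Rightarrow>
   ('v \<Rightarrow> complex) set" where
  "invariants G s \<rho> = {f \<in> poly_functions s. \<forall>\<gamma>\<in>carrier G. \<forall>x. f (\<rho> \<gamma> x) = f x}"

text \<open>The set \<open>S\<close> is meant to be a subgroup, to which the representations are restricted.\<close>

definition equivariants ::
  "'g set \<Rightarrow> (complex \<Rightarrow> 'v::ab_group_add \<Rightarrow> 'v) \<Rightarrow> ('g \<Rightarrow> 'v \<Rightarrow> 'v) \<Rightarrow> ('g \<Rightarrow> 'v \<Rightarrow> 'v) \<Rightarrow>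
   ('v \<Rightarrow> 'v) set" where
  "equivariants S s \<rho> \<eta> = {g \<in> poly_maps s. \<forall>\<kappa>\<in>S. \<forall>x. g (\<rho> \<kappa> x) = \<eta> \<kappa> (g x)}"

definition relative_equivariants ::
  "('g, 'z) monoid_scheme \<Rightarrow> ('g \<Rightarrow> complex) \<Rightarrow> (complex \<Rightarrow> 'v::ab_group_add \<Rightarrow> 'v) \<Rightarrow>
   ('g \<Rightarrow> 'v \<Rightarrow> 'v) \<Rightarrow> ('g \<Rightarrow> 'v \<Rightarrow> 'v) \<Rightarrow> ('v \<Rightarrow> 'v) set" where
  "relative_equivariants G \<tau> s \<rho> \<eta> =
     {g \<in> poly_maps s. \<forall>\<gamma>\<in>carrier G. \<forall>x. g (\<rho> \<gamma> x) = s (\<tau> \<gamma>) (\<eta> \<gamma> (g x))}"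


section \<open>Module structure and direct sums\<close>

definition invariant_ring ::
  "('g, 'z) monoid_scheme \<Rightarrow> (complex \<Rightarrow> 'v::ab_group_add \<Rightarrow> 'v) \<Rightarrow> ('g \<Rightarrow> 'v \<Rightarrow> 'v) \<Rightarrow>
   ('v \<Rightarrow> complex) ring" where
  "invariant_ring G s \<rho> =
     \<lparr>carrier = invariants G s \<rho>, mult = (\<lambda>f g x. f x * g x), one = (\<lambda>_. 1),
      zero = (\<lambda>_. 0), add = (\<lambda>f g x. f x + g x)\<rparr>"

text \<open>
  The record type of modules extends that of rings, but the locale of modules does not refer to the
  fields \<open>mult\<close> and \<open>one\<close> of the module.
\<close>

definition map_module ::
  "(complex \<Rightarrow> 'v::ab_group_add \<Rightarrow> 'v) \<Rightarrow> ('v \<Rightarrow> 'v) set \<Rightarrow> ('v \<Rightarrow> complex, 'v \<Rightarrow> 'v) module" where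
  "map_module s N =
     \<lparr>carrier = N, mult = undefined, one = undefined,
      zero = (\<lambda>_. 0), add = (\<lambda>g h x. g x + h x), smult = (\<lambda>f g x. s (f x) (g x))\<rparr>"

definition is_direct_sum ::
  "('a, 'y) ring_scheme \<Rightarrow> ('a, 'b, 'z) module_scheme \<Rightarrow> 'i set \<Rightarrow> ('i \<Rightarrow> 'b set) \<Rightarrow> bool" where
  "is_direct_sum R M I N \<longleftrightarrow>
     finite I \<and> Module.module R M \<and> (\<forall>i\<in>I. submodule (N i) R M) \<and>
     (\<forall>x\<in>carrier M. \<exists>!f. f \<in> (\<Pi>\<^sub>E i\<in>I. N i) \<and> x = finsum M f I)"

end

theory Submission
  imports Defs
begin

text \<open>
  For a \<open>K\<close>-equivariant map \<open>g\<close>, the map \<open>x \<mapsto> \<eta>(\<gamma>)\<^sup>-\<^sup>1 g(\<rho>(\<gamma>) x)\<close> depends on \<open>\<gamma>\<close> only through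
  \<open>z = \<sigma>(\<gamma>)\<close>, so it defines a map \<open>g\<^sub>z\<close> for each \<open>m\<close>-th root of unity \<open>z\<close>. This is an action of the
  cyclic group \<open>\<Gamma>/K\<close>, whose isotypic components are the relative equivariants: the \<open>j\<close>-th component
  of \<open>g\<close> is the average of \<open>z\<^sup>-\<^sup>j g\<^sub>z\<close> over \<open>z\<close>, and existence and uniqueness of the decomposition
  follow from the two orthogonality relations for the characters \<open>z \<mapsto> z\<^sup>j\<close>.
\<close>

section \<open>Orthogonality of the characters of the roots of unity\<close>

text \<open>A geometric sum whose numerator 1 - z^(-m) vanishes. This is the orthogonality relation
  at a fixed group element, summed over the characters; it yields existence of the
  decomposition.\<close>

lemma sum_powers_inverse_root_unity:
  fixes z :: complex
  assumes "z ^ m = 1" and "m > 0"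
  shows "(\<Sum>j<m. inverse z ^ j) = (if z = 1 then of_nat m else 0)"
proof (cases "z = 1")
  case False
  then have "inverse z \<noteq> 1"
    using inverse_eq_1_iff by blast
  then show ?thesis
    using assms False by (subst sum_gp_strict) (simp add: power_inverse)
qed simp

text \<open>The dual relation, for two fixed characters summed over the group; it yields uniqueness.
  The bounds on \<open>i\<close> and \<open>j\<close> make distinct exponents give distinct
  characters.\<close>

lemma sum_over_roots_unity:
  assumes "i < m" and "j < m"
  shows "(\<Sum>z | z ^ m = (1::complex). inverse z ^ j * z ^ i) = (if i = j then of_nat m else 0)"
proof -
  have m: "m > 0" using assms by simp
  let ?w = "\<lambda>k. cis (2 * pi * real k / real m)"
  have "(\<Sum>z | z ^ m = (1::complex). inverse z ^ j * z ^ i) = (\<Sum>k<m. inverse (?w k) ^ j * ?w k ^ i)"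
    by (rule sum.reindex_bij_betw [OF Complex.bij_betw_roots_unity[OF m], symmetric])
  \<comment> \<open>Index and exponent may be exchanged, \<open>?w k ^ j = ?w j ^ k\<close>, which
    reduces the sum to the previous lemma at the root \<open>?w j / ?w i\<close>.\<close>
  also have "\<dots> = (\<Sum>k<m. inverse (?w j / ?w i) ^ k)"
    by (intro sum.cong refl)
      (simp add: Complex.DeMoivre cis_divide cis_mult field_simps flip: cis_inverse)
  also have "\<dots> = (if ?w j / ?w i = 1 then of_nat m else 0)"
    using m by (intro sum_powers_inverse_root_unity)
      (auto simp: power_divide Complex.DeMoivre cis_multiple_2pi)
  also have "?w j / ?w i = 1 \<longleftrightarrow> i = j"
    using inj_onD[OF bij_betw_imp_inj_on[OF Complex.bij_betw_roots_unity[OF m]], of i j] assms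
    by auto
  finally show ?thesis .
qed

section \<open>Polynomial mappings\<close>

lemma poly_functions_sum:
  assumes "\<And>i. i \<in> I \<Longrightarrow> f i \<in> poly_functions s"
  shows "(\<lambda>x. \<Sum>i\<in>I. f i x) \<in> poly_functions s"
  using assms
proof (induction I rule: infinite_finite_induct)
  case (insert i I)
  then show ?case using poly_functions.add[of "f i" s "\<lambda>x. \<Sum>i\<in>I. f i x"] by simp
qed (simp_all add: poly_functions.const)

lemma linear_functional_compose:
  assumes "linear_functional s l" and "Vector_Spaces.linear s s h"
  shows "linear_functional s (\<lambda>x. l (h x))"
  using Vector_Spaces.linear_compose[of s s h "(*)" l] assms
  by (simp add: linear_functional_def o_def)

text \<open>Precomposition with a linear map respects sums and products and sends linear functionals
  to linear functionals, so it preserves the subalgebra they generate.\<close>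

lemma poly_functions_compose_linear:
  assumes "f \<in> poly_functions s" and "Vector_Spaces.linear s s h"
  shows "(\<lambda>x. f (h x)) \<in> poly_functions s"
  using assms(1)
  by induction (auto intro: poly_functions.intros linear_functional_compose[OF _ assms(2)])

lemma linear_functional_add: "linear_functional s l \<Longrightarrow> l (x + y) = l x + l y"
  and linear_functional_scale: "linear_functional s l \<Longrightarrow> l (s c x) = c * l x"
  and linear_functional_zero: "linear_functional s l \<Longrightarrow> l 0 = 0"
  unfolding linear_functional_def
  by (auto dest: Vector_Spaces.linear.axioms(3) intro: module_hom.add module_hom.scale module_hom.zero)

lemma linear_functional_sum: "linear_functional s l \<Longrightarrow> l (\<Sum>i\<in>I. f i) = (\<Sum>i\<in>I. l (f i))"
  unfolding linear_functional_def by (auto dest: Vector_Spaces.linear.axioms(3) intro: module_hom.sum)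

lemma poly_maps_zero: "(\<lambda>_. 0) \<in> poly_maps s"
  by (simp add: poly_maps_def linear_functional_zero poly_functions.const)

lemma poly_maps_add: "\<lbrakk>g \<in> poly_maps s; h \<in> poly_maps s\<rbrakk> \<Longrightarrow> (\<lambda>x. g x + h x) \<in> poly_maps s"
  by (simp add: poly_maps_def linear_functional_add poly_functions.add)

lemma poly_maps_scale:
  "\<lbrakk>f \<in> poly_functions s; g \<in> poly_maps s\<rbrakk> \<Longrightarrow> (\<lambda>x. s (f x) (g x)) \<in> poly_maps s"
  by (simp add: poly_maps_def linear_functional_scale poly_functions.mult)

lemma poly_maps_sum:
  "(\<And>i. i \<in> I \<Longrightarrow> g i \<in> poly_maps s) \<Longrightarrow> (\<lambda>x. \<Sum>i\<in>I. g i x) \<in> poly_maps s"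
  by (simp add: poly_maps_def linear_functional_sum poly_functions_sum)

text \<open>A functional composed with \<open>k\<close> is again a functional, so it sees a
  polynomial component of \<open>g\<close>; precomposing with \<open>h\<close> keeps this
  polynomial. With \<open>h = \<rho> \<gamma>\<close> and \<open>k = \<eta> (inv \<gamma>)\<close>
  it covers the translates below.\<close>

lemma poly_maps_conjugate_linear:
  assumes "g \<in> poly_maps s" and "Vector_Spaces.linear s s h" and "Vector_Spaces.linear s s k"
  shows "(\<lambda>x. k (g (h x))) \<in> poly_maps s"
proof -
  have "(\<lambda>x. l (k (g (h x)))) \<in> poly_functions s" if "linear_functional s l" for l
  proof (rule poly_functions_compose_linear[OF _ assms(2)])
    show "(\<lambda>x. l (k (g x))) \<in> poly_functions s"
      using assms(1) linear_functional_compose[OF that assms(3)] unfolding poly_maps_def by blast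
  qed
  then show ?thesis by (simp add: poly_maps_def)
qed

section \<open>Modules over the ring of invariants\<close>

lemma invariants_const: "(\<lambda>_. c) \<in> invariants G s \<rho>"
  by (simp add: invariants_def poly_functions.const)

lemma cring_invariant_ring: "cring (invariant_ring G s \<rho>)"
proof (rule cringI)
  show "abelian_group (invariant_ring G s \<rho>)"
  proof (rule abelian_groupI)
    fix f assume "f \<in> carrier (invariant_ring G s \<rho>)"
    then have "(\<lambda>x. - 1 * f x) \<in> invariants G s \<rho>"
      using poly_functions.mult[OF poly_functions.const[of "- 1"], of f s]
      by (simp add: invariants_def invariant_ring_def)
    then show "\<exists>h\<in>carrier (invariant_ring G s \<rho>).
        h \<oplus>\<^bsub>invariant_ring G s \<rho>\<^esub> f = \<zero>\<^bsub>invariant_ring G s \<rho>\<^esub>"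
      by (intro bexI[of _ "\<lambda>x. - 1 * f x"]) (simp_all add: invariant_ring_def)
  qed (auto simp: invariant_ring_def invariants_def fun_eq_iff intro: poly_functions.intros)
  show "comm_monoid (invariant_ring G s \<rho>)"
    by (rule comm_monoidI)
      (auto simp: invariant_ring_def invariants_def fun_eq_iff intro: poly_functions.intros)
qed (auto simp: invariant_ring_def fun_eq_iff algebra_simps)

text \<open>Additive inverses come from scaling by the constant invariant function -1.\<close>

lemma module_map_module:
  assumes "vector_space s"
    and zero: "(\<lambda>_. 0) \<in> N"
    and add: "\<And>g h. \<lbrakk>g \<in> N; h \<in> N\<rbrakk> \<Longrightarrow> (\<lambda>x. g x + h x) \<in> N"
    and scale: "\<And>f g. \<lbrakk>f \<in> invariants G s \<rho>; g \<in> N\<rbrakk> \<Longrightarrow> (\<lambda>x. s (f x) (g x)) \<in> N"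
  shows "Module.module (invariant_ring G s \<rho>) (map_module s N)"
proof -
  interpret vector_space s by fact
  show ?thesis
  proof (rule Module.moduleI)
    show "abelian_group (map_module s N)"
    proof (rule abelian_groupI)
      fix g assume "g \<in> carrier (map_module s N)"
      then show "\<exists>h\<in>carrier (map_module s N). h \<oplus>\<^bsub>map_module s N\<^esub> g = \<zero>\<^bsub>map_module s N\<^esub>"
        using scale[OF invariants_const[of "- 1"], of g]
        by (intro bexI[of _ "\<lambda>x. s (- 1) (g x)"]) (simp_all add: map_module_def)
    qed (auto simp: map_module_def zero add algebra_simps)
  qed (auto simp: map_module_def invariant_ring_def scale cring_invariant_ring[unfolded invariant_ring_def]
      scale_left_distrib scale_right_distrib)
qed

lemma (in Module.module) submodule_if_closed:
  assumes "H \<subseteq> carrier M" and "\<zero>\<^bsub>M\<^esub> \<in> H"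
    and "\<And>a b. \<lbrakk>a \<in> H; b \<in> H\<rbrakk> \<Longrightarrow> a \<oplus>\<^bsub>M\<^esub> b \<in> H"
    and smult: "\<And>a x. \<lbrakk>a \<in> carrier R; x \<in> H\<rbrakk> \<Longrightarrow> a \<odot>\<^bsub>M\<^esub> x \<in> H"
  shows "submodule H R M"
proof (rule submoduleI)
  fix x assume x: "x \<in> H"
  \<comment> \<open>Closure under negation is an instance of closure under scalars.\<close>
  then have "\<ominus>\<^bsub>M\<^esub> x = (\<ominus> \<one>) \<odot>\<^bsub>M\<^esub> x"
    using assms(1) by (simp add: smult_l_minus subsetD)
  then show "\<ominus>\<^bsub>M\<^esub> x \<in> H" using smult x by simp
qed (fact assms)+

text \<open>Passes from the abstract sum in the definition of direct sums to the pointwise sums used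
  in the computations.\<close>

lemma finsum_map_module:
  assumes "abelian_monoid (map_module s N)" and "finite I" and "f \<in> I \<rightarrow> N"
  shows "finsum (map_module s N) f I = (\<lambda>x. \<Sum>i\<in>I. f i x)"
proof -
  interpret abelian_monoid "map_module s N" by fact
  have [simp]: "carrier (map_module s N) = N" by (simp add: map_module_def)
  show ?thesis
    using assms(2,3)
  proof (induction I)
    case (insert i I)
    then show ?case
      by (simp add: finsum_insert Pi_iff) (simp add: map_module_def)
  qed (simp add: finsum_empty, simp add: map_module_def)
qed

section \<open>The isotypic decomposition\<close>

locale graded_representation_pair = group G + vector_space s
  for G :: "('g, 'z) monoid_scheme" (structure)
    and s :: "complex \<Rightarrow> 'v::ab_group_add \<Rightarrow> 'v" +
  fixes \<rho> \<eta> :: "'g \<Rightarrow> 'v \<Rightarrow> 'v" and \<sigma> :: "'g \<Rightarrow> complex" and m :: nat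
  assumes m_pos: "m > 0"
    and \<sigma>_epi: "\<sigma> \<in> epi G (roots_of_unity m)"
    and \<rho>_hom: "\<rho> \<in> hom G (GL s)"
    and \<eta>_hom: "\<eta> \<in> hom G (GL s)"
begin

abbreviation K where "K \<equiv> kernel G (roots_of_unity m) \<sigma>"

abbreviation Rel where "Rel j \<equiv> relative_equivariants G (\<lambda>\<gamma>. \<sigma> \<gamma> ^ j) s \<rho> \<eta>"

section \<open>Elementary properties of the character and the representations\<close>

lemma mem_K: "\<gamma> \<in> K \<longleftrightarrow> \<gamma> \<in> carrier G \<and> \<sigma> \<gamma> = 1"
  by (simp add: kernel_def roots_of_unity_def)

lemma \<sigma>_mult: "\<lbrakk>\<gamma> \<in> carrier G; \<delta> \<in> carrier G\<rbrakk> \<Longrightarrow> \<sigma> (\<gamma> \<otimes> \<delta>) = \<sigma> \<gamma> * \<sigma> \<delta>"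
  using \<sigma>_epi by (simp add: epi_def hom_def roots_of_unity_def)

lemma \<sigma>_image: "\<sigma> ` carrier G = {z. z ^ m = 1}"
  using \<sigma>_epi by (simp add: epi_def roots_of_unity_def)

lemma \<sigma>_root: "\<gamma> \<in> carrier G \<Longrightarrow> \<sigma> \<gamma> ^ m = 1"
  using \<sigma>_image by blast

lemma \<sigma>_nonzero: "\<gamma> \<in> carrier G \<Longrightarrow> \<sigma> \<gamma> \<noteq> 0"
  using \<sigma>_root m_pos by (metis power_0_left zero_neq_one less_irrefl)

lemma \<sigma>_one: "\<sigma> \<one> = 1"
  using \<sigma>_mult[of \<one> \<one>] \<sigma>_nonzero[of \<one>] by simp

lemma rep_linear: "\<lbrakk>\<theta> \<in> hom G (GL s); \<gamma> \<in> carrier G\<rbrakk> \<Longrightarrow> Vector_Spaces.linear s s (\<theta> \<gamma>)"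
  by (auto simp: hom_def GL_def)

lemma rep_mult:
  "\<lbrakk>\<theta> \<in> hom G (GL s); \<gamma> \<in> carrier G; \<delta> \<in> carrier G\<rbrakk> \<Longrightarrow> \<theta> (\<gamma> \<otimes> \<delta>) x = \<theta> \<gamma> (\<theta> \<delta> x)"
  by (simp add: hom_def GL_def)

text \<open>An injective idempotent map is the identity, and \<open>\<theta> \<one>\<close> is
  idempotent by multiplicativity.\<close>

lemma rep_one:
  assumes "\<theta> \<in> hom G (GL s)"
  shows "\<theta> \<one> x = x"
proof -
  have "bij (\<theta> \<one>)" using assms by (auto simp: hom_def GL_def)
  moreover have "\<theta> \<one> (\<theta> \<one> x) = \<theta> \<one> x" using rep_mult[OF assms, of \<one> \<one> x] by simp
  ultimately show ?thesis by (simp add: bij_def inj_eq)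
qed

lemma rep_inv:
  assumes "\<theta> \<in> hom G (GL s)" and "\<gamma> \<in> carrier G"
  shows "\<theta> (inv \<gamma>) (\<theta> \<gamma> x) = x" and "\<theta> \<gamma> (\<theta> (inv \<gamma>) x) = x"
  using rep_mult[OF assms(1), of "inv \<gamma>" \<gamma> x] rep_mult[OF assms(1), of \<gamma> "inv \<gamma>" x] assms
  by (simp_all add: rep_one)

lemma \<eta>_add: "\<gamma> \<in> carrier G \<Longrightarrow> \<eta> \<gamma> (x + y) = \<eta> \<gamma> x + \<eta> \<gamma> y"
  and \<eta>_scale: "\<gamma> \<in> carrier G \<Longrightarrow> \<eta> \<gamma> (s c x) = s c (\<eta> \<gamma> x)"
  and \<eta>_zero: "\<gamma> \<in> carrier G \<Longrightarrow> \<eta> \<gamma> 0 = 0"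
  and \<eta>_sum: "\<gamma> \<in> carrier G \<Longrightarrow> \<eta> \<gamma> (\<Sum>i\<in>I. f i) = (\<Sum>i\<in>I. \<eta> \<gamma> (f i))"
  for f :: "'i \<Rightarrow> 'v"
  using Vector_Spaces.linear.axioms(3)[OF rep_linear[OF \<eta>_hom]]
  by (auto intro: module_hom.add module_hom.scale module_hom.zero module_hom.sum)

section \<open>The action of the group on mappings by translation\<close>

text \<open>A right action of the group: translating by \<open>\<delta>\<close> and then by
  \<open>\<gamma>\<close> is translating by \<open>\<delta> \<otimes> \<gamma>\<close>. Its fixed
  points among polynomial mappings are the equivariants of the whole group.\<close>

definition translate :: "'g \<Rightarrow> ('v \<Rightarrow> 'v) \<Rightarrow> 'v \<Rightarrow> 'v" where
  "translate \<gamma> g x = \<eta> (inv \<gamma>) (g (\<rho> \<gamma> x))"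

lemma translate_poly_maps:
  "\<lbrakk>\<gamma> \<in> carrier G; g \<in> poly_maps s\<rbrakk> \<Longrightarrow> translate \<gamma> g \<in> poly_maps s"
  unfolding translate_def
  by (rule poly_maps_conjugate_linear[where h = "\<rho> \<gamma>" and k = "\<eta> (inv \<gamma>)"])
    (simp_all add: rep_linear \<rho>_hom \<eta>_hom)

text \<open>Applying \<open>\<eta> (inv \<gamma>)\<close> to the defining relation cancels
  \<open>\<eta> \<gamma>\<close>, so relative equivariants are common eigenvectors of all
  translations.\<close>

lemma translate_Rel:
  "\<lbrakk>\<gamma> \<in> carrier G; g \<in> Rel j\<rbrakk> \<Longrightarrow> translate \<gamma> g x = s (\<sigma> \<gamma> ^ j) (g x)"
  by (simp add: translate_def relative_equivariants_def \<eta>_scale rep_inv \<eta>_hom)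

text \<open>The quotient \<open>\<gamma> \<otimes> inv \<delta>\<close> lies in \<open>K\<close>, so
  equivariance moves it through \<open>g\<close>, where \<open>inv \<gamma>\<close> absorbs it and
  leaves \<open>inv \<delta>\<close>. Hence the action factors through the roots of unity.\<close>

lemma translate_cong:
  assumes "g \<in> equivariants K s \<rho> \<eta>" and "\<gamma> \<in> carrier G" and "\<delta> \<in> carrier G" and "\<sigma> \<gamma> = \<sigma> \<delta>"
  shows "translate \<gamma> g = translate \<delta> g"
proof
  fix x
  let ?\<kappa> = "\<gamma> \<otimes> inv \<delta>"
  have closed: "?\<kappa> \<in> carrier G" "inv \<gamma> \<in> carrier G" using assms(2,3) by simp_all
  have \<gamma>: "?\<kappa> \<otimes> \<delta> = \<gamma>" using assms(2,3) by (simp add: m_assoc)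
  have "\<sigma> ?\<kappa> * \<sigma> \<delta> = \<sigma> \<delta>"
    using \<sigma>_mult[OF closed(1) assms(3)] unfolding \<gamma> assms(4) by (rule sym)
  then have "?\<kappa> \<in> K" using closed(1) \<sigma>_nonzero[OF assms(3)] by (simp add: mem_K)
  then have "g (\<rho> ?\<kappa> (\<rho> \<delta> x)) = \<eta> ?\<kappa> (g (\<rho> \<delta> x))"
    using assms(1) by (simp add: equivariants_def)
  moreover have "\<rho> \<gamma> x = \<rho> ?\<kappa> (\<rho> \<delta> x)"
    using rep_mult[OF \<rho>_hom closed(1) assms(3)] unfolding \<gamma> .
  moreover have "\<eta> (inv \<delta>) y = \<eta> (inv \<gamma>) (\<eta> ?\<kappa> y)" for y
  proof -
    have "inv \<gamma> \<otimes> ?\<kappa> = inv \<delta>" using assms(2,3) by (simp flip: m_assoc)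
    then show ?thesis using rep_mult[OF \<eta>_hom closed(2,1)] by metis
  qed
  ultimately show "translate \<gamma> g x = translate \<delta> g x"
    by (simp add: translate_def)
qed

lemma translate_rep:
  assumes "\<gamma> \<in> carrier G" and "\<delta> \<in> carrier G"
  shows "translate \<delta> g (\<rho> \<gamma> x) = \<eta> \<gamma> (translate (\<delta> \<otimes> \<gamma>) g x)"
  using assms
  by (simp add: translate_def rep_mult[OF \<rho>_hom] rep_mult[OF \<eta>_hom] inv_mult_group rep_inv \<eta>_hom)

section \<open>Isotypic projections\<close>

text \<open>A set-theoretic section of \<open>\<sigma>\<close>, in general not multiplicative. By
  \<open>translate_cong\<close> the choice of lifts does not affect the translates of
  \<open>K\<close>-equivariant mappings.\<close>

definition lift :: "complex \<Rightarrow> 'g" where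
  "lift z = inv_into (carrier G) \<sigma> z"

lemma lift: "z ^ m = 1 \<Longrightarrow> lift z \<in> carrier G" "z ^ m = 1 \<Longrightarrow> \<sigma> (lift z) = z"
  unfolding lift_def using \<sigma>_image
  by (simp_all add: inv_into_into f_inv_into_f)

text \<open>A discrete Fourier coefficient, at frequency \<open>j\<close>, of the function
  \<open>z \<mapsto> translate (lift z) g x\<close>.\<close>

definition component :: "nat \<Rightarrow> ('v \<Rightarrow> 'v) \<Rightarrow> 'v \<Rightarrow> 'v" where
  "component j g x =
     s (inverse (of_nat m)) (\<Sum>z | z ^ m = 1. s (inverse z ^ j) (translate (lift z) g x))"

text \<open>Precomposing with \<open>\<rho> \<gamma>\<close> shifts the average by
  \<open>\<sigma> \<gamma>\<close>; undoing the shift in the weights z^(-j) releases the factor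
  \<open>\<sigma> \<gamma> ^ j\<close>.\<close>

lemma component_Rel:
  assumes g: "g \<in> equivariants K s \<rho> \<eta>"
  shows "component j g \<in> Rel j"
proof -
  have "component j g \<in> poly_maps s"
    unfolding component_def using g
    by (intro poly_maps_scale[of "\<lambda>_. _"] poly_maps_sum translate_poly_maps poly_functions.const)
      (auto simp: lift equivariants_def)
  moreover have "component j g (\<rho> \<gamma> x) = s (\<sigma> \<gamma> ^ j) (\<eta> \<gamma> (component j g x))"
    if \<gamma>: "\<gamma> \<in> carrier G" for \<gamma> x
  proof -
    let ?t = "\<lambda>z. \<eta> \<gamma> (translate (lift z) g x)"
    have "(\<Sum>z | z ^ m = 1. s (inverse z ^ j) (translate (lift z) g (\<rho> \<gamma> x))) =
        (\<Sum>z | z ^ m = 1. s (\<sigma> \<gamma> ^ j * inverse (z * \<sigma> \<gamma>) ^ j) (?t (z * \<sigma> \<gamma>)))"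
    proof (rule sum.cong)
      fix z :: complex assume "z \<in> {z. z ^ m = 1}"
      then have z: "z ^ m = 1" "(z * \<sigma> \<gamma>) ^ m = 1"
        using \<gamma> by (simp_all add: power_mult_distrib \<sigma>_root)
      \<comment> \<open>The two group elements may differ, but they have the same image under
        \<open>\<sigma>\<close>.\<close>
      have "translate (lift z \<otimes> \<gamma>) g = translate (lift (z * \<sigma> \<gamma>)) g"
        using z \<gamma> by (intro translate_cong[OF g]) (simp_all add: lift \<sigma>_mult)
      then show "s (inverse z ^ j) (translate (lift z) g (\<rho> \<gamma> x)) =
          s (\<sigma> \<gamma> ^ j * inverse (z * \<sigma> \<gamma>) ^ j) (?t (z * \<sigma> \<gamma>))"
        using z \<gamma> \<sigma>_nonzero[OF \<gamma>] by (simp add: translate_rep lift power_mult_distrib field_simps)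
    qed simp
    \<comment> \<open>Multiplication by \<open>\<sigma> \<gamma>\<close> permutes the roots of
      unity.\<close>
    also have "\<dots> = (\<Sum>z | z ^ m = 1. s (\<sigma> \<gamma> ^ j * inverse z ^ j) (?t z))"
      using \<gamma> \<sigma>_nonzero[OF \<gamma>]
      by (intro sum.reindex_bij_witness[of _ "\<lambda>z. z / \<sigma> \<gamma>" "\<lambda>z. z * \<sigma> \<gamma>"])
        (auto simp: power_mult_distrib power_divide \<sigma>_root)
    finally show ?thesis
      using \<gamma> by (simp add: component_def \<eta>_scale \<eta>_sum scale_sum_right mult_ac)
  qed
  ultimately show ?thesis by (simp add: relative_equivariants_def)
qed

text \<open>After exchanging the sums, the character sum over \<open>j\<close> removes every root
  except \<open>z = 1\<close>, whose translate is \<open>g\<close> itself.\<close>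

lemma sum_component:
  assumes g: "g \<in> equivariants K s \<rho> \<eta>"
  shows "(\<Sum>j<m. component j g x) = g x"
proof -
  let ?t = "\<lambda>z. translate (lift z) g x"
  have "(\<Sum>j<m. component j g x) =
      s (inverse (of_nat m)) (\<Sum>z | z ^ m = 1. \<Sum>j<m. s (inverse z ^ j) (?t z))"
    unfolding component_def scale_sum_right[symmetric]
    by (subst sum.swap) (rule refl)
  also have "(\<Sum>z | z ^ m = 1. \<Sum>j<m. s (inverse z ^ j) (?t z)) =
      (\<Sum>z | z ^ m = (1::complex). if z = 1 then s (of_nat m) (?t 1) else 0)"
  proof (rule sum.cong)
    fix z :: complex assume "z \<in> {z. z ^ m = 1}"
    then have "(\<Sum>j<m. inverse z ^ j) = (if z = 1 then of_nat m else 0)"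
      using m_pos by (intro sum_powers_inverse_root_unity) auto
    then show "(\<Sum>j<m. s (inverse z ^ j) (?t z)) = (if z = 1 then s (of_nat m) (?t 1) else 0)"
      by (simp only: scale_sum_left[symmetric]) simp
  qed simp
  also have "\<dots> = s (of_nat m) (?t 1)"
    using m_pos by (subst sum.delta) (auto intro!: finite_roots_unity)
  \<comment> \<open>\<open>lift 1\<close> need not be \<open>\<one>\<close>, but it lies in
    \<open>K\<close>.\<close>
  also have "?t 1 = translate \<one> g x"
    using translate_cong[OF g, of "lift 1" \<one>] by (simp add: lift \<sigma>_one)
  also have "\<dots> = g x"
    by (simp add: translate_def rep_one \<rho>_hom \<eta>_hom)
  finally show ?thesis using m_pos by simp
qed

text \<open>Each \<open>f i\<close> is an eigenvector, so the translate at \<open>z\<close> is the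
  sum of the z^i \<open>f i\<close>; orthogonality over the roots then isolates the index
  \<open>j\<close>.\<close>

lemma component_sum:
  assumes f: "\<And>i. i < m \<Longrightarrow> f i \<in> Rel i" and j: "j < m"
  shows "component j (\<lambda>x. \<Sum>i<m. f i x) x = f j x"
proof -
  have "translate (lift z) (\<lambda>x. \<Sum>i<m. f i x) x = (\<Sum>i<m. s (z ^ i) (f i x))" if "z ^ m = 1" for z
  proof -
    have "translate (lift z) (\<lambda>x. \<Sum>i<m. f i x) x = (\<Sum>i<m. translate (lift z) (f i) x)"
      using lift[OF that] by (simp add: translate_def \<eta>_sum)
    also have "\<dots> = (\<Sum>i<m. s (z ^ i) (f i x))"
      using lift[OF that] f translate_Rel[of "lift z" "f i" i x for i]
      by (intro sum.cong refl) auto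
    finally show ?thesis .
  qed
  then have "component j (\<lambda>x. \<Sum>i<m. f i x) x =
      s (inverse (of_nat m)) (\<Sum>z | z ^ m = 1. \<Sum>i<m. s (inverse z ^ j * z ^ i) (f i x))"
    by (simp add: component_def scale_sum_right)
  also have "(\<Sum>z | z ^ m = 1. \<Sum>i<m. s (inverse z ^ j * z ^ i) (f i x)) =
      (\<Sum>i<m. s (\<Sum>z | z ^ m = 1. inverse z ^ j * z ^ i) (f i x))"
    by (subst sum.swap) (simp add: scale_sum_left)
  also have "\<dots> = (\<Sum>i<m. if i = j then s (of_nat m) (f j x) else 0)"
    using j by (intro sum.cong) (auto simp: sum_over_roots_unity)
  also have "\<dots> = s (of_nat m) (f j x)"
    using j by simp
  finally show ?thesis using m_pos by simp
qed

section \<open>The modules and their direct sum\<close>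

lemma Rel_subset_equivariants: "Rel j \<subseteq> equivariants K s \<rho> \<eta>"
  by (auto simp: relative_equivariants_def equivariants_def mem_K)

text \<open>Scaling by an invariant of the whole group preserves \<open>K\<close>-equivariance
  because \<open>K\<close> is contained in the group.\<close>

lemma module_equivariants:
  "Module.module (invariant_ring G s \<rho>) (map_module s (equivariants K s \<rho> \<eta>))"
proof (rule module_map_module[OF vector_space_axioms])
qed (auto simp: equivariants_def invariants_def mem_K \<eta>_add \<eta>_scale \<eta>_zero
    intro: poly_maps_zero poly_maps_add poly_maps_scale)

lemma submodule_Rel:
  "submodule (Rel j) (invariant_ring G s \<rho>) (map_module s (equivariants K s \<rho> \<eta>))"
  by (rule Submission.module.submodule_if_closed[OF module_equivariants])
    (use Rel_subset_equivariants in \<open>auto simp: map_module_def invariant_ring_def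
      relative_equivariants_def invariants_def \<eta>_add \<eta>_scale \<eta>_zero scale_right_distrib mult.commute
      intro: poly_maps_zero poly_maps_add poly_maps_scale\<close>)

lemma isotypic_decomposition:
  "is_direct_sum (invariant_ring G s \<rho>) (map_module s (equivariants K s \<rho> \<eta>)) {..<m} Rel"
proof -
  let ?M = "map_module s (equivariants K s \<rho> \<eta>)"
  interpret M: Module.module "invariant_ring G s \<rho>" ?M
    by (rule module_equivariants)
  have finsum: "finsum ?M f {..<m} = (\<lambda>x. \<Sum>i<m. f i x)" if "f \<in> (\<Pi> i\<in>{..<m}. Rel i)" for f
    using that Rel_subset_equivariants
    by (intro finsum_map_module M.abelian_monoid_axioms) auto
  have "\<exists>!f. f \<in> (\<Pi>\<^sub>E i\<in>{..<m}. Rel i) \<and> g = finsum ?M f {..<m}" if "g \<in> carrier ?M" for g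
  proof (rule ex1I)
    have g: "g \<in> equivariants K s \<rho> \<eta>" using that by (simp add: map_module_def)
    \<comment> \<open>The restriction makes the family \<open>undefined\<close> off the index set,
      as membership in \<open>\<Pi>\<^sub>E\<close> demands.\<close>
    let ?c = "\<lambda>j\<in>{..<m}. component j g"
    have "?c \<in> (\<Pi>\<^sub>E i\<in>{..<m}. Rel i)" using component_Rel[OF g] by simp
    moreover from this have "g = finsum ?M ?c {..<m}"
      by (subst finsum) (auto simp: sum_component[OF g] fun_eq_iff)
    ultimately show "?c \<in> (\<Pi>\<^sub>E i\<in>{..<m}. Rel i) \<and> g = finsum ?M ?c {..<m}" ..
    fix f assume f: "f \<in> (\<Pi>\<^sub>E i\<in>{..<m}. Rel i) \<and> g = finsum ?M f {..<m}"
    then have g_sum: "g = (\<lambda>x. \<Sum>i<m. f i x)" using finsum[of f] by auto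
    \<comment> \<open>Applying the projections to any decomposition recovers its summands, so
      \<open>g\<close> determines them.\<close>
    have "component j g = f j" if "j < m" for j
      unfolding g_sum using f that by (intro ext component_sum) auto
    then show "f = ?c" using f by (intro extensionalityI[of f "{..<m}"]) (auto simp: PiE_iff)
  qed
  then show ?thesis
    unfolding is_direct_sum_def using module_equivariants submodule_Rel by simp
qed

end

theorem theorem2p6:
  fixes G :: "('g, 'z) monoid_scheme"
    and T :: "'g topology"
    and d :: nat
    and A :: "('g set \<times> ('g \<Rightarrow> nat \<Rightarrow> real)) set"
    and s :: "complex \<Rightarrow> 'v::ab_group_add \<Rightarrow> 'v"
    and B :: "'v set"
    and \<rho> \<eta> :: "'g \<Rightarrow> 'v \<Rightarrow> 'v"
    and \<sigma> :: "'g \<Rightarrow> complex"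
    and m :: nat
  assumes "m \<ge> 2"
    and "compact_lie_group G T d A"
    and "\<sigma> \<in> epi G (roots_of_unity m)"
    and "finite_dimensional_vector_space s B"
    and "lie_representation G T s \<rho>"
    and "lie_representation G T s \<eta>"
  shows "is_direct_sum (invariant_ring G s \<rho>)
           (map_module s (equivariants (kernel G (roots_of_unity m) \<sigma>) s \<rho> \<eta>))
           {0..m - 1}
           (\<lambda>j. relative_equivariants G (\<lambda>\<gamma>. \<sigma> \<gamma> ^ j) s \<rho> \<eta>)"
proof -
  interpret compact_lie_group G T d A by fact
  interpret finite_dimensional_vector_space s B by fact
  interpret graded_representation_pair G s \<rho> \<eta> \<sigma> m
    using assms by unfold_locales (simp_all add: lie_representation_def)
  \<comment> \<open>The subtraction is truncated, so positivity of \<open>m\<close> matters: for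
    \<open>m = 0\<close> the left side would be \<open>{0}\<close>.\<close>
  have "{0..m - 1} = {..<m}" using \<open>m \<ge> 2\<close> by auto
  then show ?thesis using isotypic_decomposition by simp
qed

end
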